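(* Let $F$ be a field. (i) Let $D$ be a central simple associative division algebra over $F$ with norm $N_{D/F}:D\to F$, let $\sigma_1,\sigma_2,\sigma_3,\sigma_4\in \mathrm{Aut}_F(D)$ and $c\in D^{\times}$. If $N_{D/F}(c)\notin N_{D/F}(D^{\times})^2$, then $\mathrm{Cay}(D,c,\sigma_1,\sigma_2,\sigma_3,\sigma_4)$ is a division algebra. (ii) Let $K/F$ be a finite field extension with norm $N_{K/F}$, let $\sigma_1,\sigma_2,\sigma_3,\sigma_4\in \mathrm{Aut}_F(K)$ and $c\in K^{\times}$. If $K$ is separable over $F$ and $N_{K/F}(c)\notin N_{K/F}(K^{\times})^2$, then $\mathrm{Cay}(K,c,\sigma_1,\sigma_2,\sigma_3,\sigma_4)$ is a division algebra.
   Context: For $E=D$ or $E=K$, $\mathrm{Cay}(E,c,\sigma_1,\sigma_2,\sigma_3,\sigma_4)$ denotes the $F$-vector space $E\oplus E$ with the (not necessarily associative) multiplication $(u,v)(x,y)=(ux+c\sigma_1(v)\sigma_2(y),\ \sigma_3(u)y+v\sigma_4(x))$. A finite-dimensional nonassociative $F$-algebra $A$ is a division algebra if for every nonzero $a\in A$ the maps $x\mapsto ax$ and $x\mapsto xa$ are bijective (equivalently, $A$ has no zero divisors). $N_{D/F}$ is the (reduced) norm of the central simple algebra $D$, a multiplicative form with $N_{D/F}(x)=0$ iff $x=0$. $N_{E/F}(E^{\times})^2$ denotes the set $\{N_{E/F}(x)^2 \mid x\in E^{\times}\}$. *)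

theory Defs
  imports
    "HOL-Algebra.Algebraic_Closure_Type"
    "HOL-Library.Product_Plus"
    "Jordan_Normal_Form.Determinant"
begin

text \<open>
  An \<open>F\<close>-vector space is a scalar multiplication \<open>s :: 'f \<Rightarrow> 'a \<Rightarrow> 'a\<close> satisfying
  \<^locale>\<open>vector_space\<close>, with \<open>F\<close> the type \<open>'f::field\<close>. An \<open>F\<close>-algebra adds a bilinear product
  on \<open>'a\<close>, which is an arbitrary function for nonassociative algebras and the ring
  multiplication of \<open>'a\<close> for unital associative ones.
\<close>

definition fin_dim :: "('f::field \<Rightarrow> 'a::ab_group_add \<Rightarrow> 'a) \<Rightarrow> bool" where
  "fin_dim s \<longleftrightarrow> (\<exists>B. finite_dimensional_vector_space s B)"

definition nonassoc_algebra ::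
  "('f::field \<Rightarrow> 'a::ab_group_add \<Rightarrow> 'a) \<Rightarrow> ('a \<Rightarrow> 'a \<Rightarrow> 'a) \<Rightarrow> bool" where
  "nonassoc_algebra s m \<longleftrightarrow>
     (\<forall>a. Vector_Spaces.linear s s (m a)) \<and> (\<forall>a. Vector_Spaces.linear s s (\<lambda>x. m x a))"

definition division_algebra ::
  "('f::field \<Rightarrow> 'a::ab_group_add \<Rightarrow> 'a) \<Rightarrow> ('a \<Rightarrow> 'a \<Rightarrow> 'a) \<Rightarrow> bool" where
  "division_algebra s m \<longleftrightarrow> nonassoc_algebra s m \<and> fin_dim s \<and>
     (\<forall>a. a \<noteq> 0 \<longrightarrow> bij (\<lambda>x. m a x) \<and> bij (\<lambda>x. m x a))"

text \<open>
  The associative algebra is carried by a \<^class>\<open>division_ring\<close>, so that it is simple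
  automatically; centrality says that its centre is \<open>F 1\<close>.
\<close>

definition central_simple_division_algebra ::
  "('f::field \<Rightarrow> 'd::division_ring \<Rightarrow> 'd) \<Rightarrow> bool" where
  "central_simple_division_algebra s \<longleftrightarrow> nonassoc_algebra s (*) \<and> fin_dim s \<and>
     {z. \<forall>x. z * x = x * z} = range (\<lambda>a. s a 1)"

definition finite_field_extension :: "('f::field \<Rightarrow> 'k::field \<Rightarrow> 'k) \<Rightarrow> bool" where
  "finite_field_extension s \<longleftrightarrow> nonassoc_algebra s (*) \<and> fin_dim s"

text \<open>
  Every element has a separable minimal polynomial: a monic irreducible annihilating polynomial
  all of whose roots in an algebraic closure of \<open>F\<close> are simple. The map \<open>a \<mapsto> s a 1\<close> is the
  inclusion of \<open>F\<close> in \<open>K\<close>.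
\<close>

definition separable_extension :: "('f::field \<Rightarrow> 'k::field \<Rightarrow> 'k) \<Rightarrow> bool" where
  "separable_extension s \<longleftrightarrow>
     (\<forall>x. \<exists>p. irreducible p \<and> lead_coeff p = 1 \<and> poly (map_poly (\<lambda>a. s a 1) p) x = 0 \<and>
        rsquarefree (map_poly to_ac p))"

definition Aut :: "('f::field \<Rightarrow> 'a::ring_1 \<Rightarrow> 'a) \<Rightarrow> ('a \<Rightarrow> 'a) set" where
  "Aut s = {\<sigma>. Vector_Spaces.linear s s \<sigma> \<and> bij \<sigma> \<and> \<sigma> 1 = 1 \<and> (\<forall>x y. \<sigma> (x * y) = \<sigma> x * \<sigma> y)}"

text \<open>
  \<open>\<phi>\<close> is a homomorphism of \<open>F\<close>-algebras from \<open>D\<close> to the \<open>n \<times> n\<close> matrices over the algebraic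
  closure \<open>L\<close> of \<open>F\<close> whose \<open>L\<close>-linear extension \<open>D \<otimes>\<^sub>F L \<rightarrow> M\<^sub>n(L)\<close> is an isomorphism. An
  \<open>F\<close>-basis \<open>B\<close> of \<open>D\<close> is an \<open>L\<close>-basis of \<open>D \<otimes>\<^sub>F L\<close>, so bijectivity of the extension says that
  every \<open>n \<times> n\<close> matrix over \<open>L\<close> is a unique \<open>L\<close>-linear combination of the \<open>\<phi> b\<close>, \<open>b \<in> B\<close>.
\<close>

definition splitting ::
  "('f::field \<Rightarrow> 'd::division_ring \<Rightarrow> 'd) \<Rightarrow> nat \<Rightarrow> ('d \<Rightarrow> 'f alg_closure mat) \<Rightarrow> bool" where
  "splitting s n \<phi> \<longleftrightarrow>
     (\<forall>x. \<phi> x \<in> carrier_mat n n) \<and>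
     \<phi> 1 = 1\<^sub>m n \<and>
     (\<forall>x y. \<phi> (x + y) = \<phi> x + \<phi> y) \<and>
     (\<forall>x y. \<phi> (x * y) = \<phi> x * \<phi> y) \<and>
     (\<forall>a x. \<phi> (s a x) = to_ac a \<cdot>\<^sub>m \<phi> x) \<and>
     (\<exists>B. finite_dimensional_vector_space s B \<and>
        (\<forall>M \<in> carrier_mat n n. \<exists>!c. c \<in> B \<rightarrow>\<^sub>E UNIV \<and>
           M = mat n n (\<lambda>(i, j). \<Sum>b\<in>B. c b * \<phi> b $$ (i, j))))"

text \<open>
  The reduced norm is \<open>x \<mapsto> det (\<phi> x)\<close>. For a central simple algebra a splitting exists, and this
  function takes values in \<open>F\<close> and does not depend on \<open>\<phi>\<close>, so exactly one \<open>N\<close> satisfies the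
  predicate.
\<close>

definition is_reduced_norm ::
  "('f::field \<Rightarrow> 'd::division_ring \<Rightarrow> 'd) \<Rightarrow> ('d \<Rightarrow> 'f) \<Rightarrow> bool" where
  "is_reduced_norm s N \<longleftrightarrow> (\<exists>n \<phi>. splitting s n \<phi> \<and> (\<forall>x. to_ac (N x) = det (\<phi> x)))"

definition ordered_basis :: "('f::field \<Rightarrow> 'a::ab_group_add \<Rightarrow> 'a) \<Rightarrow> 'a list \<Rightarrow> bool" where
  "ordered_basis s bs \<longleftrightarrow> distinct bs \<and> finite_dimensional_vector_space s (set bs)"

definition regular_mat ::
  "('f::field \<Rightarrow> 'k::field \<Rightarrow> 'k) \<Rightarrow> 'k list \<Rightarrow> 'k \<Rightarrow> 'f mat" where
  "regular_mat s bs x = mat (length bs) (length bs)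
     (\<lambda>(i, j). module.representation s (set bs) (x * bs ! j) (bs ! i))"

text \<open>
  The norm is the determinant of multiplication by \<open>x\<close> as an \<open>F\<close>-linear map, which does not
  depend on the basis.
\<close>

definition field_norm :: "('f::field \<Rightarrow> 'k::field \<Rightarrow> 'k) \<Rightarrow> 'k \<Rightarrow> 'f" where
  "field_norm s x = det (regular_mat s (SOME bs. ordered_basis s bs) x)"

definition prod_scale :: "('f \<Rightarrow> 'a \<Rightarrow> 'a) \<Rightarrow> 'f \<Rightarrow> 'a \<times> 'a \<Rightarrow> 'a \<times> 'a" where
  "prod_scale s a = map_prod (s a) (s a)"

fun cay :: "'a::ring_1 \<Rightarrow> ('a \<Rightarrow> 'a) \<Rightarrow> ('a \<Rightarrow> 'a) \<Rightarrow> ('a \<Rightarrow> 'a) \<Rightarrow> ('a \<Rightarrow> 'a) \<Rightarrow>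
    'a \<times> 'a \<Rightarrow> 'a \<times> 'a \<Rightarrow> 'a \<times> 'a" where
  "cay c \<sigma>\<^sub>1 \<sigma>\<^sub>2 \<sigma>\<^sub>3 \<sigma>\<^sub>4 (u, v) (x, y) =
     (u * x + c * \<sigma>\<^sub>1 v * \<sigma>\<^sub>2 y, \<sigma>\<^sub>3 u * y + v * \<sigma>\<^sub>4 x)"

end

theory Submission
  imports Defs "HOL-Analysis.Product_Vector"
begin

text \<open>
  Let \<open>N\<close> be a multiplicative form that is invariant under \<open>F\<close>-automorphisms, and suppose that
  \<open>(u, v)(x, y) = 0\<close> with both factors nonzero. If one of the four entries vanished, the two
  component equations would force a whole factor to vanish. So all entries are nonzero, and taking
  norms in \<open>u x = - c \<sigma>\<^sub>1(v) \<sigma>\<^sub>2(y)\<close> and \<open>\<sigma>\<^sub>3(u) y = - v \<sigma>\<^sub>4(x)\<close> gives two equations between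
  elements of \<open>F\<close>. Dividing one by the other cancels \<open>N(u)\<close>, \<open>N(v)\<close> and the sign \<open>N(-1)\<close> and
  leaves \<open>N(c) = N(x / y)\<^sup>2\<close>, which is excluded (\<open>cay_no_zero_divisors\<close>). In finite dimension the
  absence of zero divisors makes all multiplication maps bijective.

  It remains to see that the two norms are invariant. The field norm is the determinant of the
  multiplication map \<open>L\<^sub>x\<close>, and \<open>L\<^bsub>\<sigma>(x)\<^esub> = \<sigma> L\<^sub>x \<sigma>\<^sup>-\<^sup>1\<close>. For the reduced norm it suffices that an
  automorphism of \<open>D\<close> is inner, since a splitting turns conjugation in \<open>D\<close> into conjugation of
  matrices. This case of the Skolem--Noether theorem (\<open>automorphism_inner\<close>) is proved inside \<open>D\<close>.
  Because the centre is \<open>F\<close>, every \<open>F\<close>-linear map \<open>D \<rightarrow> D\<close> has the form \<open>x \<mapsto> \<Sum>\<^sub>b f(b) x b\<close>, with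
  \<open>b\<close> running over a basis, and the coefficients \<open>f(b)\<close> are unique. Writing an automorphism
  \<open>\<sigma>\<close> in this form and comparing coefficients in \<open>\<sigma>(x y) = \<sigma>(x) \<sigma>(y)\<close>, as maps of \<open>y\<close>, yields
  \<open>f(b) x = \<sigma>(x) f(b)\<close>, so any nonzero \<open>f(b)\<close> conjugates \<open>x\<close> to \<open>\<sigma>(x)\<close>.
\<close>

section \<open>Norm forms and zero divisors\<close>

definition aut_norm :: "('f::field \<Rightarrow> 'a::ring_1 \<Rightarrow> 'a) \<Rightarrow> ('a \<Rightarrow> 'f) \<Rightarrow> bool" where
  "aut_norm s N \<longleftrightarrow> N 1 = 1 \<and> (\<forall>x y. N (x * y) = N x * N y) \<and>
     (\<forall>\<sigma>\<in>Aut s. \<forall>x. N (\<sigma> x) = N x)"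

text \<open>
  With \<open>a = (u, v)\<close> and \<open>b = (x, y)\<close>, the norms of the two component equations combine to
  \<open>N(c) = N(x y\<^sup>-\<^sup>1)\<^sup>2\<close>.
\<close>

lemma cay_no_zero_divisors:
  fixes s :: "'f::field \<Rightarrow> 'a::division_ring \<Rightarrow> 'a"
  assumes norm: "aut_norm s N"
    and aut: "\<sigma>\<^sub>1 \<in> Aut s" "\<sigma>\<^sub>2 \<in> Aut s" "\<sigma>\<^sub>3 \<in> Aut s" "\<sigma>\<^sub>4 \<in> Aut s"
    and c: "c \<noteq> 0" "\<And>x. x \<noteq> 0 \<Longrightarrow> N c \<noteq> (N x)\<^sup>2"
    and zero: "cay c \<sigma>\<^sub>1 \<sigma>\<^sub>2 \<sigma>\<^sub>3 \<sigma>\<^sub>4 a b = 0"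
  shows "a = 0 \<or> b = 0"
proof (rule ccontr)
  assume nz: "\<not> (a = 0 \<or> b = 0)"
  obtain u v x y where ab: "a = (u, v)" "b = (x, y)"
    by (metis surj_pair)
  have N1: "N 1 = 1" and Nmult: "N (x * y) = N x * N y" for x y
    using norm by (auto simp: aut_norm_def)
  have N\<sigma>: "N (\<sigma>\<^sub>1 z) = N z" "N (\<sigma>\<^sub>2 z) = N z" "N (\<sigma>\<^sub>3 z) = N z" "N (\<sigma>\<^sub>4 z) = N z" for z
    using norm aut by (auto simp: aut_norm_def)
  have N_nz: "N z \<noteq> 0" if "z \<noteq> 0" for z
    using Nmult[of z "inverse z"] that N1 by auto
  have aut_zero: "\<sigma> z = 0 \<longleftrightarrow> z = 0" if "\<sigma> \<in> Aut s" for \<sigma> z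
  proof -
    have "Vector_Spaces.linear s s \<sigma>" "inj \<sigma>"
      using that by (auto simp: Aut_def bij_def)
    then show ?thesis
      by (metis injD Vector_Spaces.linear_iff_module_hom module_hom.zero)
  qed
  have eq1: "u * x = - (c * \<sigma>\<^sub>1 v * \<sigma>\<^sub>2 y)" and eq2: "\<sigma>\<^sub>3 u * y = - (v * \<sigma>\<^sub>4 x)"
    using zero by (auto simp: ab zero_prod_def eq_neg_iff_add_eq_0)
  have uvxy: "u \<noteq> 0 \<and> v \<noteq> 0 \<and> x \<noteq> 0 \<and> y \<noteq> 0"
  proof -
    have "u * x = 0 \<longleftrightarrow> v = 0 \<or> y = 0" "u = 0 \<or> y = 0 \<longleftrightarrow> v = 0 \<or> x = 0"
      using arg_cong[OF eq1, of "\<lambda>z. z = 0"] arg_cong[OF eq2, of "\<lambda>z. z = 0"] c(1) aut[THEN aut_zero]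
      by simp_all
    then show ?thesis
      using nz by (auto simp: ab zero_prod_def)
  qed
  (* Only \<open>N (- 1)\<^sup>2 = 1\<close> is available: \<open>N (- 1) = - 1\<close> occurs in odd degree. One factor
    \<open>N (- 1)\<close> arises in each of the two norm equations, so they cancel. *)
  have sign: "N (- z) = N (- 1) * N z" for z
    using Nmult[of "- 1" z] by simp
  have sign_sq: "N (- 1) * N (- 1) = 1"
    using Nmult[of "- 1" "- 1"] N1 by simp
  have n1: "N u * N x = N (- 1) * (N c * N v * N y)"
    using arg_cong[OF eq1, of N] unfolding sign[of "c * \<sigma>\<^sub>1 v * \<sigma>\<^sub>2 y"] by (simp add: Nmult N\<sigma>)
  have n2: "N u * N y = N (- 1) * (N v * N x)"
    using arg_cong[OF eq2, of N] unfolding sign[of "v * \<sigma>\<^sub>4 x"] by (simp add: Nmult N\<sigma>)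
  have nzs: "N u \<noteq> 0" "N v \<noteq> 0" "N x \<noteq> 0" "N y \<noteq> 0"
    using uvxy N_nz by auto
  have "N (- 1) * (N c * N v * N y) * N y = N (- 1) * (N v * N x) * N x"
    unfolding n1[symmetric] n2[symmetric] by (simp add: mult_ac)
  then have "(N (- 1) * N v) * (N c * (N y)\<^sup>2) = (N (- 1) * N v) * (N x)\<^sup>2"
    by (simp add: power2_eq_square mult_ac)
  then have "N c * (N y)\<^sup>2 = (N x)\<^sup>2"
    using nzs sign_sq by auto
  moreover have "N x = N (x * inverse y) * N y"
    using uvxy by (simp flip: Nmult add: mult.assoc)
  ultimately have "N c = (N (x * inverse y))\<^sup>2"
    using nzs by (simp add: power_mult_distrib)
  then show False
    using c(2)[of "x * inverse y"] uvxy by simp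
qed

lemma linearD:
  assumes "Vector_Spaces.linear s t f"
  shows "f (x + y) = f x + f y" "f (s k x) = t k (f x)" "f 0 = 0"
  using assms by (auto simp: Vector_Spaces.linear_iff_module_hom module_hom.add module_hom.scale
      module_hom.zero)

lemma scale_mult:
  fixes s :: "'f::field \<Rightarrow> 'a::ring_1 \<Rightarrow> 'a"
  assumes "nonassoc_algebra s (*)"
  shows "x * s k y = s k (x * y)" "s k x * y = s k (x * y)"
  using assms linearD(2)[of s s "(*) x"] linearD(2)[of s s "\<lambda>z. z * y"]
  by (auto simp: nonassoc_algebra_def)

lemma cay_nonassoc_algebra:
  fixes s :: "'f::field \<Rightarrow> 'a::ring_1 \<Rightarrow> 'a"
  assumes alg: "nonassoc_algebra s (*)"
    and aut: "\<sigma>\<^sub>1 \<in> Aut s" "\<sigma>\<^sub>2 \<in> Aut s" "\<sigma>\<^sub>3 \<in> Aut s" "\<sigma>\<^sub>4 \<in> Aut s"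
    and vs: "vector_space (prod_scale s)"
  shows "nonassoc_algebra (prod_scale s) (cay c \<sigma>\<^sub>1 \<sigma>\<^sub>2 \<sigma>\<^sub>3 \<sigma>\<^sub>4)"
proof -
  interpret V: vector_space s
    using aut(1) by (auto simp: Aut_def Vector_Spaces.linear_def)
  have lin: "Vector_Spaces.linear s s \<sigma>\<^sub>1" "Vector_Spaces.linear s s \<sigma>\<^sub>2"
    "Vector_Spaces.linear s s \<sigma>\<^sub>3" "Vector_Spaces.linear s s \<sigma>\<^sub>4"
    using aut by (auto simp: Aut_def)
  note simps = lin[THEN linearD(1)] lin[THEN linearD(2)] scale_mult[OF alg]
    prod_scale_def algebra_simps
  show ?thesis
    unfolding nonassoc_algebra_def Vector_Spaces.linear_iff
    using vs by (auto simp: simps)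
qed

lemma prod_scale_finite_dimensional:
  assumes "finite_dimensional_vector_space s B"
  obtains C where "finite_dimensional_vector_space (prod_scale s) C"
proof -
  interpret V: finite_dimensional_vector_space s B by fact
  interpret P: finite_dimensional_vector_space_prod s s B B by unfold_locales
  have "P.scale = prod_scale s"
    by (auto simp: fun_eq_iff P.scale_def prod_scale_def)
  then show thesis
    using that P.p.finite_dimensional_vector_space_axioms by metis
qed

lemma division_algebraI:
  assumes alg: "nonassoc_algebra s m" and fin: "fin_dim s"
    and zero: "\<And>a b. m a b = 0 \<Longrightarrow> a = 0 \<or> b = 0"
  shows "division_algebra s m"
proof -
  obtain B where "finite_dimensional_vector_space s B"
    using fin by (auto simp: fin_dim_def)
  then interpret V: finite_dimensional_vector_space s B .
  have bij: "bij f" if "Vector_Spaces.linear s s f" "\<And>x. f x = 0 \<Longrightarrow> x = 0" for f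
  proof -
    interpret f: Vector_Spaces.linear s s f by fact
    have "inj f"
      using that(2) by (simp add: f.inj_iff_eq_0)
    then show ?thesis
      using V.linear_inj_imp_surj[OF that(1)] by (simp add: bij_def)
  qed
  show ?thesis
    using alg fin zero unfolding division_algebra_def nonassoc_algebra_def
    by (auto intro!: bij)
qed

lemma cay_division_algebra:
  fixes s :: "'f::field \<Rightarrow> 'a::division_ring \<Rightarrow> 'a"
  assumes alg: "nonassoc_algebra s (*)" and fin: "fin_dim s"
    and norm: "aut_norm s N"
    and aut: "\<sigma>\<^sub>1 \<in> Aut s" "\<sigma>\<^sub>2 \<in> Aut s" "\<sigma>\<^sub>3 \<in> Aut s" "\<sigma>\<^sub>4 \<in> Aut s"
    and c: "c \<noteq> 0" "N c \<notin> {(N x)\<^sup>2 | x. x \<noteq> 0}"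
  shows "division_algebra (prod_scale s) (cay c \<sigma>\<^sub>1 \<sigma>\<^sub>2 \<sigma>\<^sub>3 \<sigma>\<^sub>4)"
proof (rule division_algebraI)
  show fin': "fin_dim (prod_scale s)"
    using fin prod_scale_finite_dimensional unfolding fin_dim_def by metis
  then have "vector_space (prod_scale s)"
    by (auto simp: fin_dim_def finite_dimensional_vector_space_def)
  then show "nonassoc_algebra (prod_scale s) (cay c \<sigma>\<^sub>1 \<sigma>\<^sub>2 \<sigma>\<^sub>3 \<sigma>\<^sub>4)"
    by (rule cay_nonassoc_algebra[OF alg aut])
  show "a = 0 \<or> b = 0" if "cay c \<sigma>\<^sub>1 \<sigma>\<^sub>2 \<sigma>\<^sub>3 \<sigma>\<^sub>4 a b = 0" for a b
    using cay_no_zero_divisors[OF norm aut c(1) _ that] c(2) by blast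
qed

section \<open>Automorphisms of central division algebras are inner\<close>

locale central_division_algebra = vector_space scale
  for scale :: "'f::field \<Rightarrow> 'd::division_ring \<Rightarrow> 'd" (infixr \<open>*s\<close> 75) +
  assumes scale_mult_right: "x * (k *s y) = k *s (x * y)"
    and scale_mult_left: "(k *s x) * y = k *s (x * y)"
    and centre: "(\<And>x. z * x = x * z) \<Longrightarrow> \<exists>k. z = k *s 1"
begin

text \<open>
  This is the injectivity of \<open>D \<otimes> D\<^sup>o\<^sup>p \<rightarrow> End\<^sub>F(D)\<close>: the coefficients of a map
  \<open>x \<mapsto> \<Sum>\<^sub>b f(b) x b\<close> over independent \<open>b\<close> are determined by the map. A vanishing sum with one
  coefficient normalised to \<open>1\<close> yields, by commuting with an arbitrary \<open>y\<close>, a shorter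
  vanishing sum with coefficients \<open>y f(b) - f(b) y\<close>. By induction these are zero, so all \<open>f(b)\<close>
  are central, hence scalars, and evaluation at \<open>1\<close> is a linear relation between the \<open>b\<close>.
\<close>

lemma two_sided_sum_eq_0:
  assumes "finite B" "independent B" "\<And>x. (\<Sum>b\<in>B. f b * x * b) = 0" "b \<in> B"
  shows "f b = 0"
  using assms
proof (induction B arbitrary: f b rule: finite_psubset_induct)
  case (psubset B)
  show ?case
  proof (rule ccontr)
    assume nz: "f b \<noteq> 0"
    define g where "g a = inverse (f b) * f a" for a
    have g_b: "g b = 1"
      using nz by (simp add: g_def)
    have g_sum: "(\<Sum>a\<in>B. g a * x * a) = 0" for x
    proof -
      have "(\<Sum>a\<in>B. g a * x * a) = inverse (f b) * (\<Sum>a\<in>B. f a * x * a)"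
        by (simp add: g_def mult.assoc sum_distrib_left)
      then show ?thesis
        by (simp add: psubset.prems(2))
    qed
    \<comment> \<open>Commuting with \<open>y\<close> cancels the term of \<open>b\<close>, whose coefficient is \<open>1\<close>.\<close>
    have comm: "y * g a = g a * y" if "a \<in> B" for a y
    proof (cases "a = b")
      case False
      have "(\<Sum>a\<in>B - {b}. (y * g a - g a * y) * x * a) = 0" for x
      proof -
        have "(\<Sum>a\<in>B. (y * g a - g a * y) * x * a)
            = y * (\<Sum>a\<in>B. g a * x * a) - (\<Sum>a\<in>B. g a * (y * x) * a)"
          by (simp add: sum_distrib_left sum_subtractf algebra_simps)
        also have "\<dots> = 0"
          by (simp add: g_sum)
        finally show ?thesis
          using psubset.prems(3) psubset.hyps by (simp add: sum.remove g_b)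
      qed
      moreover have "B - {b} \<subset> B" "independent (B - {b})" "a \<in> B - {b}"
        using psubset.prems(3) that False independent_mono[OF psubset.prems(1), of "B - {b}"] by auto
      ultimately have "y * g a - g a * y = 0"
        using psubset.IH[of "B - {b}" "\<lambda>a. y * g a - g a * y" a] by blast
      then show ?thesis
        by simp
    qed (simp add: g_b)
    have "\<forall>a. \<exists>k. a \<in> B \<longrightarrow> g a = k *s 1"
      using comm centre by metis
    then obtain k where k: "\<And>a. a \<in> B \<Longrightarrow> g a = k a *s 1"
      by metis
    have "(\<Sum>a\<in>B. k a *s a) = (\<Sum>a\<in>B. g a * 1 * a)"
      by (intro sum.cong) (simp_all add: k scale_mult_left)
    then have "(\<Sum>a\<in>B. k a *s a) = 0"
      by (simp only: g_sum)
    then have "k b = 0"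
      using independentD[OF psubset.prems(1) psubset.hyps order_refl] psubset.prems(3) by metis
    then show False
      using k[of b] g_b psubset.prems(3) by simp
  qed
qed

text \<open>
  The image of \<open>D \<otimes> D\<^sup>o\<^sup>p\<close> in \<open>End\<^sub>F(D)\<close>, the algebra generated by left and right
  multiplications.
\<close>

inductive multiplication_map :: "('d \<Rightarrow> 'd) \<Rightarrow> bool" where
  two_sided: "multiplication_map (\<lambda>x. a * x * b)"
| plus: "multiplication_map S \<Longrightarrow> multiplication_map T \<Longrightarrow> multiplication_map (\<lambda>x. S x + T x)"

lemma multiplication_map_id: "multiplication_map (\<lambda>x. x)"
  using two_sided[of 1 1] by simp

lemma multiplication_map_compose_two_sided:
  "multiplication_map T \<Longrightarrow> multiplication_map (\<lambda>x. p * T x * q)"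
proof (induction rule: multiplication_map.induct)
  case (two_sided a b)
  show ?case
    using multiplication_map.two_sided[of "p * a" "b * q"] by (simp add: mult.assoc)
next
  case (plus S T)
  then show ?case
    using multiplication_map.plus[OF plus.IH] by (simp add: algebra_simps)
qed

lemma multiplication_map_left:
  "multiplication_map T \<Longrightarrow> multiplication_map (\<lambda>x. p * T x)"
  using multiplication_map_compose_two_sided[of T p 1] by simp

lemma multiplication_map_right:
  "multiplication_map T \<Longrightarrow> multiplication_map (\<lambda>x. T x * q)"
  using multiplication_map_compose_two_sided[of T 1 q] by simp

lemma multiplication_map_diff:
  "multiplication_map S \<Longrightarrow> multiplication_map T \<Longrightarrow> multiplication_map (\<lambda>x. S x - T x)"
  using plus[OF _ multiplication_map_left[of T "- 1"], of S] by simp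

lemma multiplication_map_sum:
  assumes "\<And>i. i \<in> I \<Longrightarrow> multiplication_map (T i)"
  shows "multiplication_map (\<lambda>x. \<Sum>i\<in>I. T i x)"
proof -
  have zero: "multiplication_map (\<lambda>x. 0)"
    using two_sided[of 0 0] by simp
  show ?thesis
    using assms zero by (induction I rule: infinite_finite_induct) (auto intro: plus)
qed

lemma multiplication_map_basis_form:
  assumes "multiplication_map T" and B: "finite B" "independent B" "span B = UNIV"
  shows "\<exists>f. \<forall>x. T x = (\<Sum>b\<in>B. f b * x * b)"
  using assms(1)
proof (induction rule: multiplication_map.induct)
  case (two_sided p q)
  have "p * x * q = (\<Sum>b\<in>B. (representation B q b *s p) * x * b)" for x
  proof -
    have "p * x * q = p * x * (\<Sum>b\<in>B. representation B q b *s b)"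
      using B by (subst sum_representation_eq) auto
    then show ?thesis
      by (simp add: sum_distrib_left scale_mult_left scale_mult_right)
  qed
  then show ?case
    by (intro exI[of _ "\<lambda>b. representation B q b *s p"]) blast
next
  case (plus S T)
  then obtain f g where "\<And>x. S x = (\<Sum>b\<in>B. f b * x * b)" "\<And>x. T x = (\<Sum>b\<in>B. g b * x * b)"
    by blast
  then show ?case
    by (intro exI[of _ "\<lambda>b. f b + g b"]) (simp add: sum.distrib distrib_right)
qed

text \<open>
  This is the density theorem for \<open>D\<close> as a simple module over its multiplication maps, with
  endomorphism ring \<open>F\<close>. Given a dual family \<open>T\<close> for \<open>B\<close> and a new vector \<open>c\<close>, correcting a
  map \<open>S\<close> by \<open>\<Sum>\<^sub>b S(b) T\<^sub>b\<close> makes it vanish on \<open>B\<close>. If the corrected map always vanished at \<open>c\<close>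
  as well, then \<open>S(c) = \<Sum>\<^sub>b S(b) T\<^sub>b(c)\<close> for all \<open>S\<close>. Applied to \<open>x \<mapsto> T\<^sub>b(x) y\<close> this makes every
  \<open>T\<^sub>b(c)\<close> central, hence a scalar, and applied to the identity it expresses \<open>c\<close> as a linear
  combination of \<open>B\<close>. So some corrected map is nonzero at \<open>c\<close>, and after normalisation it both
  serves as the dual map of \<open>c\<close> and corrects the old ones at \<open>c\<close>.
\<close>

lemma multiplication_map_dual_family:
  assumes "finite B" "independent B"
  shows "\<exists>T. (\<forall>b\<in>B. multiplication_map (T b)) \<and>
    (\<forall>b\<in>B. \<forall>a\<in>B. T b a = (if a = b then 1 else 0))"
  using assms
proof (induction B rule: finite_induct)
  case empty
  then show ?case by simp
next
  case (insert c B)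
  have indep: "independent B"
    using insert.prems by (rule independent_mono) auto
  then obtain T where T: "\<And>b. b \<in> B \<Longrightarrow> multiplication_map (T b)"
    and dual: "\<And>a b. a \<in> B \<Longrightarrow> b \<in> B \<Longrightarrow> T b a = (if a = b then 1 else 0)"
    using insert.IH by blast
  define residual where "residual S x = S x - (\<Sum>b\<in>B. S b * T b x)" for S x
  have residual_mult: "multiplication_map (residual S)" if "multiplication_map S" for S
    unfolding residual_def
    by (intro multiplication_map_diff multiplication_map_sum that multiplication_map_left T)
  have residual_B: "residual S b = 0" if "b \<in> B" for S b
  proof -
    have "(\<Sum>a\<in>B. S a * T a b) = (\<Sum>a\<in>B. if a = b then S b else 0)"
      using that by (intro sum.cong) (auto simp: dual)
    then show ?thesis
      using insert.hyps that by (simp add: residual_def)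
  qed
  have "\<exists>S. multiplication_map S \<and> residual S c \<noteq> 0"
  proof (rule ccontr)
    assume "\<not> ?thesis"
    then have at_c: "S c = (\<Sum>b\<in>B. S b * T b c)" if "multiplication_map S" for S
      using that by (auto simp: residual_def)
    have central: "y * T b c = T b c * y" if b: "b \<in> B" for b y
    proof -
      have "T b c * y = T b b * (y * T b c)"
      proof -
        have "T b c * y = (\<Sum>a\<in>B. T b a * y * T a c)"
          using at_c[OF multiplication_map_right[OF T[OF b], of y]] .
        also have "\<dots> = (\<Sum>a\<in>B. if a = b then y * T b c else 0)"
          using b by (intro sum.cong) (auto simp: dual)
        finally show ?thesis
          using insert.hyps b by (simp add: dual)
      qed
      then show ?thesis
        using b by (simp add: dual)
    qed
    have "\<forall>b. \<exists>k. b \<in> B \<longrightarrow> T b c = k *s 1"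
      using central centre by metis
    then obtain k where k: "\<And>b. b \<in> B \<Longrightarrow> T b c = k b *s 1"
      by metis
    have "c = (\<Sum>b\<in>B. b * T b c)"
      using at_c[OF multiplication_map_id] .
    also have "\<dots> = (\<Sum>b\<in>B. k b *s b)"
      by (intro sum.cong) (simp_all add: k scale_mult_right)
    also have "\<dots> \<in> span B"
      by (intro span_sum span_scale span_base)
    finally have "c \<in> span B" .
    then show False
      using insert.prems insert.hyps by (simp add: independent_insert)
  qed
  then obtain S where S: "multiplication_map S" "residual S c \<noteq> 0"
    by blast
  define P where "P x = inverse (residual S c) * residual S x" for x
  have P: "multiplication_map P"
    unfolding P_def by (intro multiplication_map_left residual_mult S)
  have P_c: "P c = 1" and P_B: "\<And>b. b \<in> B \<Longrightarrow> P b = 0"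
    using S(2) by (simp_all add: P_def residual_B)
  define T' where "T' b = (if b = c then P else (\<lambda>x. T b x - T b c * P x))" for b
  have "multiplication_map (T' b)" if "b \<in> insert c B" for b
  proof (cases "b = c")
    case False
    then show ?thesis
      using that T unfolding T'_def
      by (auto intro!: multiplication_map_diff multiplication_map_left P)
  qed (simp add: T'_def P)
  moreover have "T' b a = (if a = b then 1 else 0)" if "a \<in> insert c B" "b \<in> insert c B" for a b
    using that insert.hyps P_c P_B dual by (auto simp: T'_def)
  ultimately show ?case
    by blast
qed

text \<open>
  With a dual family \<open>T\<close> for a basis, \<open>\<Sum>\<^sub>b \<sigma>(b) T\<^sub>b\<close> agrees with \<open>\<sigma>\<close> on the basis.
\<close>

lemma linear_imp_multiplication_map:
  assumes B: "finite B" "independent B" "span B = UNIV" and \<sigma>: "Vector_Spaces.linear scale scale \<sigma>"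
  shows "multiplication_map \<sigma>"
proof -
  interpret \<sigma>: Vector_Spaces.linear scale scale \<sigma> by fact
  obtain T where T: "\<And>b. b \<in> B \<Longrightarrow> multiplication_map (T b)"
    and dual: "\<And>a b. a \<in> B \<Longrightarrow> b \<in> B \<Longrightarrow> T b a = (if a = b then 1 else 0)"
    using multiplication_map_dual_family[OF B(1,2)] by blast
  define S where "S x = (\<Sum>b\<in>B. \<sigma> b * T b x)" for x
  have S: "multiplication_map S"
    unfolding S_def by (intro multiplication_map_sum multiplication_map_left T)
  have "Vector_Spaces.linear scale scale S"
  proof -
    obtain f where "\<And>x. S x = (\<Sum>b\<in>B. f b * x * b)"
      using multiplication_map_basis_form[OF S B] by blast
    then show ?thesis
      unfolding Vector_Spaces.linear_iff
      by (simp add: vector_space_axioms sum.distrib scale_sum_right algebra_simps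
          scale_mult_left scale_mult_right)
  qed
  moreover have "S a = \<sigma> a" if "a \<in> B" for a
  proof -
    have "S a = (\<Sum>b\<in>B. if b = a then \<sigma> a else 0)"
      unfolding S_def using that by (intro sum.cong) (auto simp: dual)
    then show ?thesis
      using B(1) that by simp
  qed
  ultimately have "S = \<sigma>"
  proof -
    interpret VP: vector_space_pair scale scale by unfold_locales
    assume "Vector_Spaces.linear scale scale S" "\<And>a. a \<in> B \<Longrightarrow> S a = \<sigma> a"
    then show ?thesis
      using VP.linear_eq_on_span[OF _ \<sigma>, of S B] B(3) by blast
  qed
  with S show ?thesis
    by simp
qed

text \<open>
  For fixed \<open>x\<close>, the two sides of \<open>\<sigma>(x y) = \<sigma>(x) \<sigma>(y)\<close> are multiplication maps of \<open>y\<close> with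
  coefficients \<open>f(b) x\<close> and \<open>\<sigma>(x) f(b)\<close>, which therefore coincide.
\<close>

theorem automorphism_inner:
  assumes B: "finite B" "independent B" "span B = UNIV" and \<sigma>: "\<sigma> \<in> Aut scale"
  obtains g where "g \<noteq> 0" "\<And>x. \<sigma> x = g * x * inverse g"
proof -
  have lin: "Vector_Spaces.linear scale scale \<sigma>" and \<sigma>_1: "\<sigma> 1 = 1"
    and \<sigma>_mult: "\<And>x y. \<sigma> (x * y) = \<sigma> x * \<sigma> y"
    using \<sigma> by (auto simp: Aut_def)
  obtain f where f: "\<And>x. \<sigma> x = (\<Sum>b\<in>B. f b * x * b)"
    using multiplication_map_basis_form[OF linear_imp_multiplication_map[OF B lin] B] by blast
  have comm: "f b * x = \<sigma> x * f b" if "b \<in> B" for b x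
  proof -
    have "(\<Sum>b\<in>B. (f b * x - \<sigma> x * f b) * y * b) = 0" for y
    proof -
      have "(\<Sum>b\<in>B. (f b * x - \<sigma> x * f b) * y * b) = \<sigma> (x * y) - \<sigma> x * \<sigma> y"
        by (simp add: f[of "x * y"] f[of y] sum_distrib_left sum_subtractf algebra_simps)
      then show ?thesis
        by (simp add: \<sigma>_mult)
    qed
    then have "f b * x - \<sigma> x * f b = 0"
      by (rule two_sided_sum_eq_0[OF B(1,2) _ that])
    then show ?thesis
      by simp
  qed
  obtain b where b: "b \<in> B" "f b \<noteq> 0"
  proof -
    have "(\<Sum>b\<in>B. f b * 1 * b) \<noteq> 0"
      unfolding f[symmetric] by (simp add: \<sigma>_1)
    then obtain b where "b \<in> B" "f b * 1 * b \<noteq> 0"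
      by (rule sum.not_neutral_contains_not_neutral)
    then show thesis
      using that[of b] by auto
  qed
  have "\<sigma> x = f b * x * inverse (f b)" for x
    using comm[OF b(1), of x] b(2) by (simp add: mult.assoc)
  then show thesis
    using that b(2) by blast
qed

end

section \<open>Automorphism invariance of the reduced norm and the field norm\<close>

lemma det_conjugate:
  fixes A :: "'a::comm_ring_1 mat"
  assumes "P \<in> carrier_mat n n" "A \<in> carrier_mat n n" "Q \<in> carrier_mat n n" "P * Q = 1\<^sub>m n"
  shows "det (P * A * Q) = det A"
proof -
  have "det P * det Q = 1"
    using det_mult[OF assms(1,3)] assms(4) by simp
  moreover have "det (P * A * Q) = det A * (det P * det Q)"
    using assms(1-3) by (simp add: det_mult[of _ n] mult_ac)
  ultimately show ?thesis
    by simp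
qed

text \<open>
  If \<open>\<sigma>\<close> is conjugation by \<open>g\<close>, then \<open>\<phi>(\<sigma>(x))\<close> is conjugate to \<open>\<phi>(x)\<close> by the invertible matrix
  \<open>\<phi>(g)\<close>. The identities are proved over the algebraic closure, where the determinant lives,
  and pulled back along the injection of \<open>F\<close>.
\<close>

lemma reduced_norm_aut_norm:
  assumes csa: "central_simple_division_algebra s" and norm: "is_reduced_norm s N"
  shows "aut_norm s N"
proof -
  have alg: "nonassoc_algebra s (*)" and fin: "fin_dim s"
    and centre: "{z. \<forall>x. z * x = x * z} = range (\<lambda>a. s a 1)"
    using csa by (auto simp: central_simple_division_algebra_def)
  obtain B where "finite_dimensional_vector_space s B"
    using fin by (auto simp: fin_dim_def)
  then interpret V: finite_dimensional_vector_space s B .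
  interpret D: central_division_algebra s
    using centre by unfold_locales (auto simp: scale_mult[OF alg])
  obtain n \<phi> where split: "splitting s n \<phi>" and N: "\<And>x. to_ac (N x) = det (\<phi> x)"
    using norm by (auto simp: is_reduced_norm_def)
  have carrier: "\<phi> x \<in> carrier_mat n n" and one: "\<phi> 1 = 1\<^sub>m n" and mult: "\<phi> (x * y) = \<phi> x * \<phi> y" for x y
    using split by (auto simp: splitting_def)
  have "N 1 = 1"
    by (rule injD[OF inj_to_ac]) (simp add: N one)
  moreover have "N (x * y) = N x * N y" for x y
    by (rule injD[OF inj_to_ac]) (simp add: N mult det_mult[OF carrier carrier])
  moreover have "N (\<sigma> x) = N x" if \<sigma>: "\<sigma> \<in> Aut s" for \<sigma> x
  proof -
    obtain g where g: "g \<noteq> 0" "\<And>x. \<sigma> x = g * x * inverse g"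
      using D.automorphism_inner[OF V.finite_Basis V.independent_Basis V.span_Basis \<sigma>] by metis
    have "\<phi> g * \<phi> (inverse g) = 1\<^sub>m n"
      using g(1) one by (simp flip: mult)
    then have "det (\<phi> (\<sigma> x)) = det (\<phi> x)"
      by (simp add: g(2) mult det_conjugate[OF carrier carrier carrier])
    then have "to_ac (N (\<sigma> x)) = to_ac (N x)"
      by (simp add: N)
    then show ?thesis
      by (rule injD[OF inj_to_ac])
  qed
  ultimately show ?thesis
    by (auto simp: aut_norm_def)
qed

definition basis_mat :: "('f::field \<Rightarrow> 'a::ab_group_add \<Rightarrow> 'a) \<Rightarrow> 'a list \<Rightarrow> ('a \<Rightarrow> 'a) \<Rightarrow> 'f mat" where
  "basis_mat s bs f = mat (length bs) (length bs)
     (\<lambda>(i, j). module.representation s (set bs) (f (bs ! j)) (bs ! i))"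

lemma basis_mat_carrier: "basis_mat s bs f \<in> carrier_mat (length bs) (length bs)"
  by (simp add: basis_mat_def)

lemma basis_mat_id:
  assumes "ordered_basis s bs"
  shows "basis_mat s bs (\<lambda>x. x) = 1\<^sub>m (length bs)"
proof -
  interpret V: finite_dimensional_vector_space s "set bs"
    using assms by (simp add: ordered_basis_def)
  have "distinct bs"
    using assms by (simp add: ordered_basis_def)
  then show ?thesis
    by (intro eq_matI)
      (auto simp: basis_mat_def V.representation_basis[OF V.independent_Basis] nth_eq_iff_index_eq)
qed

lemma basis_mat_compose:
  assumes "ordered_basis s bs" and f: "Vector_Spaces.linear s s f"
  shows "basis_mat s bs (\<lambda>x. f (g x)) = basis_mat s bs f * basis_mat s bs g"
proof -
  interpret V: finite_dimensional_vector_space s "set bs"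
    using assms by (simp add: ordered_basis_def)
  interpret f: Vector_Spaces.linear s s f by fact
  have dist: "distinct bs"
    using assms by (simp add: ordered_basis_def)
  have coeff: "V.representation (set bs) (f y) c =
      (\<Sum>k<length bs. V.representation (set bs) (f (bs ! k)) c * V.representation (set bs) y (bs ! k))"
    for y c
  proof -
    have "f y = f (\<Sum>b\<in>set bs. s (V.representation (set bs) y b) b)"
      by (subst V.sum_representation_eq) (auto simp: V.independent_Basis V.span_Basis)
    also have "\<dots> = (\<Sum>b\<in>set bs. s (V.representation (set bs) y b) (f b))"
      by (simp add: f.sum f.scale)
    finally have "V.representation (set bs) (f y) c =
        (\<Sum>b\<in>set bs. V.representation (set bs) (f b) c * V.representation (set bs) y b)"
      by (simp add: V.representation_sum V.representation_scale V.independent_Basis V.span_Basis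
          mult.commute)
    also have "\<dots> = (\<Sum>k<length bs. V.representation (set bs) (f (bs ! k)) c * V.representation (set bs) y (bs ! k))"
      by (rule sum.reindex_bij_betw[symmetric, OF bij_betw_nth[OF dist refl refl]])
    finally show ?thesis .
  qed
  show ?thesis
  proof (rule eq_matI)
    fix i j
    assume "i < dim_row (basis_mat s bs f * basis_mat s bs g)"
      and "j < dim_col (basis_mat s bs f * basis_mat s bs g)"
    then show "basis_mat s bs (\<lambda>x. f (g x)) $$ (i, j) = (basis_mat s bs f * basis_mat s bs g) $$ (i, j)"
      using coeff[of "g (bs ! j)" "bs ! i"]
      by (simp add: basis_mat_def scalar_prod_def atLeast0LessThan)
  qed (simp_all add: basis_mat_def)
qed

text \<open>
  Multiplicativity holds because \<open>x \<mapsto> L\<^sub>x\<close> is multiplicative. Since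
  \<open>L\<^bsub>\<sigma>(x)\<^esub> = \<sigma> L\<^sub>x \<sigma>\<^sup>-\<^sup>1\<close>, the matrices of \<open>L\<^sub>x\<close> and \<open>L\<^bsub>\<sigma>(x)\<^esub>\<close> in the same basis are conjugate, so
  the choice of basis never has to be compared with another one.
\<close>

lemma field_norm_aut_norm:
  fixes s :: "'f::field \<Rightarrow> 'k::field \<Rightarrow> 'k"
  assumes ext: "finite_field_extension s"
  shows "aut_norm s (field_norm s)"
proof -
  have alg: "nonassoc_algebra s (*)" and fin: "fin_dim s"
    using ext by (auto simp: finite_field_extension_def)
  define bs where "bs = (SOME bs. ordered_basis s bs)"
  obtain B where B: "finite_dimensional_vector_space s B"
    using fin by (auto simp: fin_dim_def)
  then interpret V: finite_dimensional_vector_space s B .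
  obtain bs' where "distinct bs'" "set bs' = B"
    using finite_distinct_list[OF V.finite_Basis] by blast
  then have "ordered_basis s bs'"
    using B by (simp add: ordered_basis_def)
  then have bs: "ordered_basis s bs"
    unfolding bs_def by (rule someI)
  have norm: "field_norm s x = det (basis_mat s bs ((*) x))" for x
    by (simp add: field_norm_def regular_mat_def basis_mat_def bs_def)
  have mult: "Vector_Spaces.linear s s ((*) x)" for x
    using alg by (simp add: nonassoc_algebra_def)
  note carrier = basis_mat_carrier[of s bs]
  have "field_norm s 1 = 1"
  proof -
    have "(*) 1 = (\<lambda>x::'k. x)"
      by (simp add: fun_eq_iff)
    then show ?thesis
      by (simp add: norm basis_mat_id[OF bs])
  qed
  moreover have "field_norm s (x * y) = field_norm s x * field_norm s y" for x y
  proof -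
    have "(*) (x * y) = (\<lambda>z. x * (y * z))"
      by (simp add: fun_eq_iff mult.assoc)
    then show ?thesis
      by (simp add: norm basis_mat_compose[OF bs mult, of x "(*) y"] det_mult[OF carrier carrier])
  qed
  moreover have "field_norm s (\<sigma> x) = field_norm s x" if "\<sigma> \<in> Aut s" for \<sigma> x
  proof -
    have lin: "Vector_Spaces.linear s s \<sigma>" and "bij \<sigma>" and \<sigma>_mult: "\<And>x y. \<sigma> (x * y) = \<sigma> x * \<sigma> y"
      using that by (auto simp: Aut_def)
    define \<tau> where "\<tau> = inv_into UNIV \<sigma>"
    have inv: "\<sigma> (\<tau> y) = y" for y
      unfolding \<tau>_def using \<open>bij \<sigma>\<close>
      by (simp add: bij_is_surj surj_f_inv_f)
    let ?M = "basis_mat s bs"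
    have "?M ((*) (\<sigma> x)) = ?M (\<lambda>y. \<sigma> (x * \<tau> y))"
      by (intro arg_cong[where f = ?M]) (simp add: \<sigma>_mult inv)
    also have "\<dots> = ?M \<sigma> * ?M ((*) x) * ?M (\<tau>)"
      by (simp only: basis_mat_compose[OF bs lin, of "\<lambda>y. x * \<tau> y"]
          basis_mat_compose[OF bs mult, of x "\<tau>"] assoc_mult_mat[OF carrier carrier carrier])
    finally have "det (?M ((*) (\<sigma> x))) = det (?M ((*) x))"
      using basis_mat_compose[OF bs lin, of "\<tau>"]
      by (simp add: inv basis_mat_id[OF bs] det_conjugate[OF carrier carrier carrier])
    then show ?thesis
      by (simp add: norm)
  qed
  ultimately show ?thesis
    by (auto simp: aut_norm_def)
qed

section \<open>Doublings of central division algebras and of fields\<close>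

theorem theorem2p1:
  fixes sD :: "'f::field \<Rightarrow> 'd::division_ring \<Rightarrow> 'd"
    and sK :: "'f \<Rightarrow> 'k::field \<Rightarrow> 'k"
  shows
    "(\<forall>N \<sigma>\<^sub>1 \<sigma>\<^sub>2 \<sigma>\<^sub>3 \<sigma>\<^sub>4 c.
        central_simple_division_algebra sD \<and> is_reduced_norm sD N \<and>
        \<sigma>\<^sub>1 \<in> Aut sD \<and> \<sigma>\<^sub>2 \<in> Aut sD \<and> \<sigma>\<^sub>3 \<in> Aut sD \<and> \<sigma>\<^sub>4 \<in> Aut sD \<and>
        c \<noteq> 0 \<and> N c \<notin> {(N x)\<^sup>2 | x. x \<noteq> 0} \<longrightarrow>
        division_algebra (prod_scale sD) (cay c \<sigma>\<^sub>1 \<sigma>\<^sub>2 \<sigma>\<^sub>3 \<sigma>\<^sub>4)) \<and>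
     (\<forall>\<sigma>\<^sub>1 \<sigma>\<^sub>2 \<sigma>\<^sub>3 \<sigma>\<^sub>4 c.
        finite_field_extension sK \<and>
        \<sigma>\<^sub>1 \<in> Aut sK \<and> \<sigma>\<^sub>2 \<in> Aut sK \<and> \<sigma>\<^sub>3 \<in> Aut sK \<and> \<sigma>\<^sub>4 \<in> Aut sK \<and>
        c \<noteq> 0 \<and> separable_extension sK \<and>
        field_norm sK c \<notin> {(field_norm sK x)\<^sup>2 | x. x \<noteq> 0} \<longrightarrow>
        division_algebra (prod_scale sK) (cay c \<sigma>\<^sub>1 \<sigma>\<^sub>2 \<sigma>\<^sub>3 \<sigma>\<^sub>4))"
proof (intro conjI allI impI; elim conjE)
  fix N \<sigma>\<^sub>1 \<sigma>\<^sub>2 \<sigma>\<^sub>3 \<sigma>\<^sub>4 c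
  assume csa: "central_simple_division_algebra sD" and norm: "is_reduced_norm sD N"
    and rest: "\<sigma>\<^sub>1 \<in> Aut sD" "\<sigma>\<^sub>2 \<in> Aut sD" "\<sigma>\<^sub>3 \<in> Aut sD" "\<sigma>\<^sub>4 \<in> Aut sD"
      "c \<noteq> 0" "N c \<notin> {(N x)\<^sup>2 | x. x \<noteq> 0}"
  show "division_algebra (prod_scale sD) (cay c \<sigma>\<^sub>1 \<sigma>\<^sub>2 \<sigma>\<^sub>3 \<sigma>\<^sub>4)"
    using csa by (intro cay_division_algebra[OF _ _ reduced_norm_aut_norm[OF csa norm] rest])
      (auto simp: central_simple_division_algebra_def)
next
  fix \<sigma>\<^sub>1 \<sigma>\<^sub>2 \<sigma>\<^sub>3 \<sigma>\<^sub>4 c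
  assume ext: "finite_field_extension sK"
    and rest: "\<sigma>\<^sub>1 \<in> Aut sK" "\<sigma>\<^sub>2 \<in> Aut sK" "\<sigma>\<^sub>3 \<in> Aut sK" "\<sigma>\<^sub>4 \<in> Aut sK"
      "c \<noteq> 0" "field_norm sK c \<notin> {(field_norm sK x)\<^sup>2 | x. x \<noteq> 0}"
  show "division_algebra (prod_scale sK) (cay c \<sigma>\<^sub>1 \<sigma>\<^sub>2 \<sigma>\<^sub>3 \<sigma>\<^sub>4)"
    using ext by (intro cay_division_algebra[OF _ _ field_norm_aut_norm[OF ext] rest])
      (auto simp: finite_field_extension_def)
qed

end
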